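(* Let $f(z)=z+\sum_{n=2}^{\infty}a_nz^n$ be a member of the class $\mathcal{S}^*_{Ne}$. Then $$\sum_{n=2}^{\infty}\left((3n)^2-7^2\right)|a_n|^2\leq 40.$$
   Context: $\mathbb{D}$ is the open unit disk. $\mathcal{A}$ is the set of analytic functions $f$ on $\mathbb{D}$ with $f(0)=0$ and $f'(0)=1$. For analytic $f,g$ on $\mathbb{D}$, $f\prec g$ means there is an analytic $w$ on $\mathbb{D}$ with $w(0)=0$, $|w(z)|<1$ and $f(z)=g(w(z))$ on $\mathbb{D}$. $\mathcal{S}^*_{Ne}=\{f\in\mathcal{A}: zf'(z)/f(z)\prec 1+z-z^3/3\}$. *)

theory Defs
  imports "HOL-Complex_Analysis.Complex_Analysis"
begin

abbreviation unit_disk :: "complex set" where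
  "unit_disk \<equiv> ball 0 1"

definition class_A :: "(complex \<Rightarrow> complex) set" where
  "class_A = {f. f holomorphic_on unit_disk \<and> f 0 = 0 \<and> deriv f 0 = 1}"

definition subordinate :: "(complex \<Rightarrow> complex) \<Rightarrow> (complex \<Rightarrow> complex) \<Rightarrow> bool" where
  "subordinate f g \<longleftrightarrow>
     f holomorphic_on unit_disk \<and> g holomorphic_on unit_disk \<and>
     (\<exists>w. w holomorphic_on unit_disk \<and> w 0 = 0 \<and>
          (\<forall>z\<in>unit_disk. norm (w z) < 1 \<and> f z = g (w z)))"

text \<open>
  The quotient \<open>z f'(z) / f(z)\<close> has a removable singularity at the origin for \<open>f\<close> in
  \<^const>\<open>class_A\<close>, with value 1 (lemma \<open>starlike_quotient_tendsto\<close>). At any other zero of \<open>f\<close>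
  in the disk it has a pole; the convention \<open>x / 0 = 0\<close> does not hide it, because
  \<^const>\<open>subordinate\<close> requires the quotient to be holomorphic on the whole disk.
\<close>

definition starlike_quotient :: "(complex \<Rightarrow> complex) \<Rightarrow> complex \<Rightarrow> complex" where
  "starlike_quotient f z = (if z = 0 then 1 else z * deriv f z / f z)"

lemma starlike_quotient_tendsto:
  assumes "f \<in> class_A"
  shows "((\<lambda>z. z * deriv f z / f z) \<longlongrightarrow> 1) (at 0)"
proof -
  have hol: "f holomorphic_on unit_disk" and f0: "f 0 = 0" and d: "deriv f 0 = 1"
    using assms by (auto simp: class_A_def)
  have "deriv f holomorphic_on unit_disk"
    using hol by (intro holomorphic_deriv) auto
  then have "isCont (deriv f) 0"
    by (meson centre_in_ball continuous_on_eq_continuous_at holomorphic_on_imp_continuous_on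
        open_ball zero_less_one)
  then have l1: "(deriv f \<longlongrightarrow> 1) (at 0)"
    using d by (simp add: isCont_def)
  have "(f has_field_derivative 1) (at 0)"
    using holomorphic_derivI[OF hol, of 0] d by simp
  then have l2: "((\<lambda>z. f z / z) \<longlongrightarrow> 1) (at 0)"
    using f0 by (simp add: has_field_derivative_iff)
  have "((\<lambda>z. deriv f z / (f z / z)) \<longlongrightarrow> 1 / 1) (at 0)"
    by (intro tendsto_divide l1 l2) simp
  then show ?thesis
    by (simp add: mult.commute)
qed

definition class_S_Ne :: "(complex \<Rightarrow> complex) set" where
  "class_S_Ne = {f \<in> class_A. subordinate (starlike_quotient f) (\<lambda>z. 1 + z - z ^ 3 / 3)}"

end

theory Submission
  imports Defs
begin

text \<open>
  On the disk \<open>\<bar>1 + w - w\<^sup>3/3\<bar> < 7/3\<close>, so \<open>\<bar>z f'(z)\<bar> \<le> 7/3 \<bar>f(z)\<bar>\<close>. Integrating the squares over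
  the circle of radius \<open>r\<close> and applying Parseval's identity to both sides gives
  \<open>\<Sum> ((3n)\<^sup>2 - 7\<^sup>2) \<bar>a\<^sub>n\<bar>\<^sup>2 r\<^sup>2\<^sup>n \<le> 0\<close>, summed from \<open>n = 1\<close>. Only the terms \<open>n \<le> 2\<close> are negative,
  so this passes to partial sums and to the limit \<open>r \<rightarrow> 1\<close>; the term \<open>n = 1\<close> contributes \<open>-40\<close>.
\<close>

section \<open>Parseval's identity for absolutely convergent Fourier series\<close>

lemma has_integral_cis_period:
  "((\<lambda>t. cis (of_int k * t)) has_integral (if k = 0 then complex_of_real (2 * pi) else 0)) {0..2 * pi}"
proof (cases "k = 0")
  case True
  have "((\<lambda>t. 1::complex) has_integral (2 * pi - 0) *\<^sub>R 1) {0..2 * pi}"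
    by (rule has_integral_const_real[THEN has_integral_eq_rhs]) auto
  then show ?thesis
    using True by (simp add: scaleR_conv_of_real)
next
  case False
  let ?F = "\<lambda>t. cis (of_int k * t) / (\<i> * of_int k)"
  have "((\<lambda>t. cis (of_int k * t)) has_integral ?F (2 * pi) - ?F 0) {0..2 * pi}"
  proof (rule fundamental_theorem_of_calculus)
    fix t :: real
    have "((\<lambda>t. exp (\<i> * of_int k * of_real t) / (\<i> * of_int k)) has_vector_derivative
            exp (\<i> * of_int k * of_real t)) (at t within {0..2 * pi})"
      using False
      by (intro has_vector_derivative_real_field[of "\<lambda>z. exp (\<i> * of_int k * z) / (\<i> * of_int k)"])
        (auto intro!: derivative_eq_intros)
    then show "(?F has_vector_derivative cis (of_int k * t)) (at t within {0..2 * pi})"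
      by (simp add: cis_conv_exp mult.assoc)
  qed auto
  moreover have "cis (of_int k * (2 * pi)) = 1"
    by (metis cis_multiple_2pi Ints_of_int mult.commute)
  ultimately show ?thesis
    using False by simp
qed

text \<open>Writing the square as the sum times its conjugate gives a double sum of
  \<open>cis ((m - n) * t)\<close>; by orthogonality only the diagonal survives integration. The
  computation is complex-valued, and real parts are taken at the end.\<close>

lemma has_integral_norm_square_trig_poly:
  "((\<lambda>t. (norm (\<Sum>n<N. b n * cis (real n * t)))\<^sup>2) has_integral 2 * pi * (\<Sum>n<N. (norm (b n))\<^sup>2))
    {0..2 * pi}"
proof -
  let ?h = "\<lambda>m n t. b m * cnj (b n) * cis (of_int (int m - int n) * t)"
  have "((\<lambda>t. \<Sum>m<N. \<Sum>n<N. ?h m n t) has_integral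
      (\<Sum>m<N. \<Sum>n<N. b m * cnj (b n) *
        (if int m - int n = 0 then complex_of_real (2 * pi) else 0))) {0..2 * pi}"
    by (intro has_integral_sum has_integral_mult_right has_integral_cis_period) auto
  moreover have "(\<Sum>m<N. \<Sum>n<N. ?h m n t) =
      of_real ((norm (\<Sum>n<N. b n * cis (real n * t)))\<^sup>2)" for t
  proof -
    have "?h m n t = (b m * cis (real m * t)) * cnj (b n * cis (real n * t))" for m n
    proof -
      have "cis (of_int (int m - int n) * t) = cis (real m * t) * cnj (cis (real n * t))"
        by (simp add: cis_cnj cis_mult left_diff_distrib)
      then show ?thesis
        by (simp add: mult_ac)
    qed
    then show ?thesis
      by (simp only: complex_norm_square sum_product cnj_sum)
  qed
  moreover have "(\<Sum>m<N. \<Sum>n<N. b m * cnj (b n) *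
        (if int m - int n = 0 then complex_of_real (2 * pi) else 0)) =
      of_real (2 * pi * (\<Sum>n<N. (norm (b n))\<^sup>2))"
  proof -
    have "(\<Sum>n<N. b m * cnj (b n) * (if int m - int n = 0 then complex_of_real (2 * pi) else 0)) =
        of_real (2 * pi) * of_real ((norm (b m))\<^sup>2)" if "m < N" for m
    proof -
      have "(\<Sum>n<N. b m * cnj (b n) * (if int m - int n = 0 then complex_of_real (2 * pi) else 0)) =
          (\<Sum>n<N. if m = n then b m * cnj (b n) * complex_of_real (2 * pi) else 0)"
        by (intro sum.cong) auto
      also have "\<dots> = b m * cnj (b m) * complex_of_real (2 * pi)"
        using that by simp
      finally show ?thesis
        by (simp only: complex_norm_square mult.commute)
    qed
    then show ?thesis
      by (simp add: sum_distrib_left)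
  qed
  ultimately have "((\<lambda>t. complex_of_real ((norm (\<Sum>n<N. b n * cis (real n * t)))\<^sup>2)) has_integral
      of_real (2 * pi * (\<Sum>n<N. (norm (b n))\<^sup>2))) {0..2 * pi}"
    by simp
  from has_integral_Re[OF this] show ?thesis
    by (simp only: Re_complex_of_real)
qed

text \<open>Absolute summability makes the partial sums converge uniformly in \<open>t\<close>, so
  the identity for trigonometric polynomials passes to the limit under the integral.\<close>

lemma parseval_absolutely_summable:
  fixes b :: "nat \<Rightarrow> complex"
  assumes b: "summable (\<lambda>n. norm (b n))"
  defines "g \<equiv> \<lambda>t. \<Sum>n. b n * cis (real n * t)"
  shows "(\<lambda>t. (norm (g t))\<^sup>2) integrable_on {0..2 * pi}"
    and "(\<lambda>n. (norm (b n))\<^sup>2) sums (integral {0..2 * pi} (\<lambda>t. (norm (g t))\<^sup>2) / (2 * pi))"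
proof -
  let ?s = "\<lambda>N t. \<Sum>n<N. b n * cis (real n * t)"
  have lim: "uniform_limit UNIV ?s g sequentially"
    unfolding g_def by (rule Weierstrass_m_test[OF _ b]) (simp add: norm_mult)
  have bound: "norm (g t) \<le> (\<Sum>n. norm (b n))" for t
    unfolding g_def
    by (rule order.trans[OF summable_norm]) (simp_all add: norm_mult b)
  have norm_lim: "uniform_limit UNIV (\<lambda>N t. norm (?s N t)) (\<lambda>t. norm (g t)) sequentially"
    using lim by (rule uniform_limit_norm)
  \<comment> \<open>Uniform convergence survives squaring only because the limit function is
    bounded.\<close>
  moreover have "bounded (range (\<lambda>t. norm (g t)))"
    using bound by (intro boundedI) auto
  ultimately have "uniform_limit UNIV (\<lambda>N t. norm (?s N t) * norm (?s N t))
      (\<lambda>t. norm (g t) * norm (g t)) sequentially"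
    by (intro uniform_lim_mult)
  then have sq_lim: "uniform_limit {0..2 * pi} (\<lambda>N t. (norm (?s N t))\<^sup>2)
      (\<lambda>t. (norm (g t))\<^sup>2) sequentially"
    unfolding power2_eq_square by (rule uniform_limit_on_subset) simp
  have "continuous_on {0..2 * pi} (\<lambda>t. (norm (?s N t))\<^sup>2)" for N
    by (intro continuous_intros)
  from uniform_limit_integral[OF sq_lim this]
  obtain I J where I: "\<And>N. ((\<lambda>t. (norm (?s N t))\<^sup>2) has_integral I N) {0..2 * pi}"
    and J: "((\<lambda>t. (norm (g t))\<^sup>2) has_integral J) {0..2 * pi}" and IJ: "I \<longlonglongrightarrow> J"
    by auto
  show "(\<lambda>t. (norm (g t))\<^sup>2) integrable_on {0..2 * pi}"
    using J by blast
  have "I = (\<lambda>N. 2 * pi * (\<Sum>n<N. (norm (b n))\<^sup>2))"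
    using I has_integral_norm_square_trig_poly has_integral_unique by blast
  then have "(\<lambda>N. 2 * pi * (\<Sum>n<N. (norm (b n))\<^sup>2) / (2 * pi)) \<longlonglongrightarrow> J / (2 * pi)"
    using IJ by (intro tendsto_divide) auto
  then show "(\<lambda>n. (norm (b n))\<^sup>2) sums (integral {0..2 * pi} (\<lambda>t. (norm (g t))\<^sup>2) / (2 * pi))"
    using integral_unique[OF J] by (simp add: sums_def)
qed

lemma suminf_norm_square_le_of_norm_le:
  fixes b c :: "nat \<Rightarrow> complex"
  assumes b: "summable (\<lambda>n. norm (b n))" and c: "summable (\<lambda>n. norm (c n))"
    and le: "\<And>t. norm (\<Sum>n. b n * cis (real n * t)) \<le> K * norm (\<Sum>n. c n * cis (real n * t))"
  shows "(\<Sum>n. (norm (b n))\<^sup>2) \<le> K\<^sup>2 * (\<Sum>n. (norm (c n))\<^sup>2)"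
proof -
  note pb = parseval_absolutely_summable[OF b] and pc = parseval_absolutely_summable[OF c]
  have "integral {0..2 * pi} (\<lambda>t. (norm (\<Sum>n. b n * cis (real n * t)))\<^sup>2) \<le>
      integral {0..2 * pi} (\<lambda>t. K\<^sup>2 * (norm (\<Sum>n. c n * cis (real n * t)))\<^sup>2)"
    \<comment> \<open>Squaring preserves \<open>le\<close> because its smaller side is a norm, hence
      nonnegative.\<close>
    using le by (intro integral_le pb(1) integrable_on_mult_right pc(1))
      (metis norm_ge_zero power_mono power_mult_distrib)
  then show ?thesis
    unfolding sums_unique[OF pb(2), symmetric] sums_unique[OF pc(2), symmetric]
    by (simp add: divide_right_mono)
qed

section \<open>Power series on circles inside the disk and the weighted coefficient
  inequality\<close>

lemma power_series_deriv_times_sums: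
  fixes A :: "nat \<Rightarrow> complex"
  assumes f: "\<And>z. norm z < R \<Longrightarrow> (\<lambda>n. A n * z ^ n) sums f z" and z: "norm z < R"
  shows "(\<lambda>n. of_nat n * A n * z ^ n) sums (z * deriv f z)"
proof -
  have sm: "summable (\<lambda>n. A n * y ^ n)" if "norm y < R" for y
    using f[OF that] by (rule sums_summable)
  have "((\<lambda>y. \<Sum>n. A n * y ^ n) has_field_derivative (\<Sum>n. diffs A n * z ^ n)) (at z)"
    using sm z by (intro termdiffs_strong')
  moreover have "eventually (\<lambda>y. (\<Sum>n. A n * y ^ n) = f y) (nhds z)"
  proof (rule eventually_mono)
    show "eventually (\<lambda>y. y \<in> ball 0 R) (nhds z)"
      using z by (intro eventually_nhds_in_open) auto
  qed (use f in \<open>auto simp: sums_iff\<close>)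
  ultimately have "(f has_field_derivative (\<Sum>n. diffs A n * z ^ n)) (at z)"
    using has_field_derivative_cong_ev by (metis DERIV_cong_ev)
  then have "deriv f z = (\<Sum>n. diffs A n * z ^ n)"
    by (rule DERIV_imp_deriv)
  moreover have "summable (\<lambda>n. diffs A n * z ^ n)"
    using termdiff_converges[of z R A] z sm by auto
  ultimately have "(\<lambda>n. diffs A n * z ^ n) sums deriv f z"
    by (simp add: sums_iff)
  from sums_mult[OF this, of z]
  have "(\<lambda>n. of_nat (Suc n) * A (Suc n) * z ^ Suc n) sums (z * deriv f z)"
    by (simp add: diffs_def mult_ac)
  \<comment> \<open>The term of index 0 carries the factor 0, so shifting the index back leaves the
    sum unchanged.\<close>
  then show ?thesis
    by (subst (asm) sums_Suc_iff) simp
qed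

lemma summable_norm_power_series:
  fixes A :: "nat \<Rightarrow> complex"
  assumes "\<And>z. norm z < 1 \<Longrightarrow> summable (\<lambda>n. A n * z ^ n)" "0 \<le> r" "r < 1"
  shows "summable (\<lambda>n. norm (A n * of_real r ^ n))"
proof -
  \<comment> \<open>Convergence at a point strictly farther out than \<open>r\<close> forces
    absolute convergence at \<open>r\<close>.\<close>
  obtain s where s: "r < s" "s < 1"
    using dense assms(3) by blast
  show ?thesis
    by (rule powser_insidea[of A "of_real s"]) (use assms s in auto)
qed

lemma sum_weighted_norm_square_le_zero:
  fixes A :: "nat \<Rightarrow> complex"
  assumes f: "\<And>z. norm z < 1 \<Longrightarrow> (\<lambda>n. A n * z ^ n) sums f z"
    and le: "\<And>z. norm z < 1 \<Longrightarrow> norm (z * deriv f z) \<le> K * norm (f z)"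
    and N: "\<And>n. n \<ge> N \<Longrightarrow> K \<le> real n" and K: "K \<ge> 0"
  shows "(\<Sum>n<N. ((real n)\<^sup>2 - K\<^sup>2) * (norm (A n))\<^sup>2) \<le> 0"
proof -
  let ?w = "\<lambda>n. (real n)\<^sup>2 - K\<^sup>2"
  have part: "(\<Sum>n<N. ?w n * (norm (A n))\<^sup>2 * r ^ (2 * n)) \<le> 0" if r: "0 < r" "r < 1" for r :: real
  proof -
    \<comment> \<open>The Fourier coefficients of \<open>z * deriv f z\<close> and of
      \<open>f\<close> on the circle of radius \<open>r\<close>.\<close>
    define b where "b n = of_nat n * A n * of_real r ^ n" for n
    define c where "c n = A n * of_real r ^ n" for n
    have sb: "summable (\<lambda>n. norm (b n))"
      unfolding b_def
      using power_series_deriv_times_sums[OF f, THEN sums_summable] r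
      by (intro summable_norm_power_series) auto
    have sc: "summable (\<lambda>n. norm (c n))"
      unfolding c_def using f[THEN sums_summable] r by (intro summable_norm_power_series) auto
    have on_circle: "norm (\<Sum>n. b n * cis (real n * t)) \<le> K * norm (\<Sum>n. c n * cis (real n * t))"
      for t
    proof -
      let ?z = "of_real r * cis t"
      have z: "norm ?z < 1"
        using r by (simp add: norm_mult)
      have "(\<Sum>n. b n * cis (real n * t)) = ?z * deriv f ?z"
        using power_series_deriv_times_sums[OF f z, THEN sums_unique] f
        by (simp add: b_def power_mult_distrib Complex.DeMoivre mult_ac)
      moreover have "(\<Sum>n. c n * cis (real n * t)) = f ?z"
        using f[OF z, THEN sums_unique]
        by (simp add: c_def power_mult_distrib Complex.DeMoivre mult_ac)
      ultimately show ?thesis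
        using le[OF z] by simp
    qed
    have b2: "summable (\<lambda>n. (norm (b n))\<^sup>2)" and c2: "summable (\<lambda>n. (norm (c n))\<^sup>2)"
      using parseval_absolutely_summable(2)[THEN sums_summable] sb sc by auto
    have eq: "?w n * (norm (A n))\<^sup>2 * r ^ (2 * n) = (norm (b n))\<^sup>2 - K\<^sup>2 * (norm (c n))\<^sup>2" for n
      using r by (simp add: b_def c_def norm_mult norm_power power_mult_distrib power_mult
          power_even_eq algebra_simps)
    have "(\<Sum>n<N. ?w n * (norm (A n))\<^sup>2 * r ^ (2 * n)) \<le>
        (\<Sum>n. (norm (b n))\<^sup>2 - K\<^sup>2 * (norm (c n))\<^sup>2)"
      unfolding eq
    proof (rule sum_le_suminf)
      show "summable (\<lambda>n. (norm (b n))\<^sup>2 - K\<^sup>2 * (norm (c n))\<^sup>2)"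
        by (intro summable_diff b2 summable_mult c2)
      fix n assume "n \<in> - {..<N}"
      then have "0 \<le> ?w n"
        using N[of n] K by (simp add: power_mono)
      then show "0 \<le> (norm (b n))\<^sup>2 - K\<^sup>2 * (norm (c n))\<^sup>2"
        unfolding eq[symmetric] using r by simp
    qed simp
    also have "\<dots> = (\<Sum>n. (norm (b n))\<^sup>2) - K\<^sup>2 * (\<Sum>n. (norm (c n))\<^sup>2)"
      by (simp add: b2 c2 suminf_diff[symmetric] suminf_mult summable_mult)
    also have "\<dots> \<le> 0"
      using suminf_norm_square_le_of_norm_le[OF sb sc on_circle] by simp
    finally show ?thesis .
  qed
  have "((\<lambda>r. \<Sum>n<N. ?w n * (norm (A n))\<^sup>2 * r ^ (2 * n)) \<longlongrightarrow>
      (\<Sum>n<N. ?w n * (norm (A n))\<^sup>2 * 1 ^ (2 * n))) (at_left (1::real))"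
    by (intro tendsto_intros)
  moreover have "eventually (\<lambda>r. (\<Sum>n<N. ?w n * (norm (A n))\<^sup>2 * r ^ (2 * n)) \<le> 0) (at_left (1::real))"
    using eventually_at_left_real[of 0 1] by (rule eventually_mono) (auto intro: part)
  ultimately show ?thesis
    using tendsto_upperbound[of _ _ "at_left (1::real)" 0] by fastforce
qed

section \<open>Growth of the logarithmic derivative on the class\<close>

text \<open>
  At a zero of \<open>f\<close> the quotient only has the junk value \<open>0\<close>; the zeros are isolated and the quotient
  is continuous, so the identity extends to them.
\<close>

lemma starlike_quotient_times:
  assumes A: "f \<in> class_A" and q: "starlike_quotient f holomorphic_on unit_disk"
    and z: "z \<in> unit_disk"
  shows "z * deriv f z = starlike_quotient f z * f z"
proof (cases "f z = 0")
  case False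
  then show ?thesis
    using A by (auto simp: starlike_quotient_def class_A_def)
next
  case True
  have hol: "f holomorphic_on unit_disk" and "f 0 = 0" "deriv f 0 = 1"
    using A by (auto simp: class_A_def)
  \<comment> \<open>Zeros are isolated only if \<open>f\<close> does not vanish identically, which
    \<open>deriv f 0 = 1\<close> excludes.\<close>
  have "\<exists>\<beta>\<in>unit_disk. f \<beta> \<noteq> 0"
  proof (rule ccontr)
    assume "\<not> ?thesis"
    then have "deriv f 0 = deriv (\<lambda>_. 0) 0"
      by (intro deriv_cong_ev refl) (auto simp: eventually_nhds intro!: exI[of _ unit_disk])
    then show False
      using \<open>deriv f 0 = 1\<close> by simp
  qed
  then obtain r where r: "r > 0" "\<And>x. x \<in> ball z r - {z} \<Longrightarrow> f x \<noteq> 0"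
    using isolated_zeros[OF hol open_ball connected_ball z True] by blast
  let ?d = "\<lambda>x. x * deriv f x - starlike_quotient f x * f x"
  have "?d holomorphic_on unit_disk"
    by (intro holomorphic_intros hol q holomorphic_deriv) auto
  then have "isCont ?d z"
    using z continuous_on_eq_continuous_at holomorphic_on_imp_continuous_on open_ball by blast
  then have "?d \<midarrow>z\<rightarrow> ?d z"
    by (simp add: isCont_def)
  \<comment> \<open>Near \<open>z\<close> but off it, \<open>f x \<noteq> 0\<close>; since
    \<open>f 0 = 0\<close>, also \<open>x \<noteq> 0\<close>, so there
    \<open>starlike_quotient\<close> is a genuine quotient and can be multiplied out.\<close>
  moreover have "eventually (\<lambda>x. ?d x = 0) (at z)"
    using r by (auto simp: eventually_at starlike_quotient_def dist_commute \<open>f 0 = 0\<close>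
        intro!: exI[of _ r])
  then have "?d \<midarrow>z\<rightarrow> 0"
    by (rule tendsto_eventually)
  ultimately have "?d z = 0"
    using tendsto_unique[OF at_neq_bot] by blast
  then show ?thesis
    by simp
qed

lemma class_S_Ne_norm_deriv_le:
  assumes f: "f \<in> class_S_Ne" and z: "z \<in> unit_disk"
  shows "norm (z * deriv f z) \<le> 7 / 3 * norm (f z)"
proof -
  from f obtain w where A: "f \<in> class_A" and q: "starlike_quotient f holomorphic_on unit_disk"
    and w: "norm (w z) < 1" "starlike_quotient f z = 1 + w z - w z ^ 3 / 3"
    using z unfolding class_S_Ne_def subordinate_def by blast
  \<comment> \<open>The constant is 1 + 1 + 1/3, from the triangle inequality alone. It is not the
    supremum, but it is the value that produces the weights:
    \<open>(3n)^2 - 7^2 = 9 * (n^2 - (7/3)^2)\<close>.\<close>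
  have "norm (1 + w z - w z ^ 3 / 3) \<le> norm (1 + w z) + norm (w z ^ 3 / 3)"
    by (rule norm_triangle_ineq4)
  also have "norm (1 + w z) \<le> 1 + norm (w z)"
    by (metis norm_one norm_triangle_ineq)
  also have "norm (w z ^ 3 / 3) \<le> 1 / 3"
    using w(1) by (simp add: norm_divide norm_power power_le_one)
  finally have "norm (starlike_quotient f z) \<le> 7 / 3"
    using w by simp
  then show ?thesis
    unfolding starlike_quotient_times[OF A q z] norm_mult by (rule mult_right_mono) simp
qed

section \<open>The coefficient bound, by partial sums\<close>

theorem theorem4p1:
  fixes f :: "complex \<Rightarrow> complex" and a :: "nat \<Rightarrow> complex"
  assumes "f \<in> class_S_Ne"
    and "\<And>z. z \<in> unit_disk \<Longrightarrow> (\<lambda>n. a (n + 2) * z ^ (n + 2)) sums (f z - z)"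
  shows "summable (\<lambda>n. ((3 * real (n + 2))\<^sup>2 - 7\<^sup>2) * (norm (a (n + 2)))\<^sup>2) \<and>
         (\<Sum>n. ((3 * real (n + 2))\<^sup>2 - 7\<^sup>2) * (norm (a (n + 2)))\<^sup>2) \<le> 40"
proof -
  \<comment> \<open>The full coefficient sequence of \<open>f\<close>: the series hypothesis says
    nothing about \<open>a 0\<close> and \<open>a 1\<close>, so the normalization supplies the
    values 0 and 1.\<close>
  define A where "A n = (if n = 0 then 0 else if n = 1 then 1 else a n)" for n
  have A2: "A (n + 2) = a (n + 2)" for n
    by (simp add: A_def)
  have low: "(\<Sum>n<2. g n * A n * z ^ n) = g 1 * z" for g :: "nat \<Rightarrow> complex" and z
    by (simp add: numeral_2_eq_2 A_def)
  have series: "(\<lambda>n. A n * z ^ n) sums f z" if "norm z < 1" for z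
  proof -
    have "(\<lambda>n. A (n + 2) * z ^ (n + 2)) sums (f z - (\<Sum>n<2. A n * z ^ n))"
      unfolding A2 using assms(2)[of z] that low[of "\<lambda>_. 1" z] by simp
    then show ?thesis
      by (rule sums_iff_shift'[THEN iffD1])
  qed
  let ?t = "\<lambda>n. ((3 * real (n + 2))\<^sup>2 - 7\<^sup>2) * (norm (a (n + 2)))\<^sup>2"
  \<comment> \<open>The cutoff \<open>N + 2\<close> must be at least 3 to lie beyond 7/3, hence
    \<open>N \<ge> 1\<close>.\<close>
  have partial: "(\<Sum>n<N. ?t n) \<le> 40" if "N \<ge> 1" for N
  proof -
    have "(\<Sum>n<N + 2. ((real n)\<^sup>2 - (7 / 3)\<^sup>2) * (norm (A n))\<^sup>2) \<le> 0"
      using series class_S_Ne_norm_deriv_le[OF assms(1)] that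
      by (intro sum_weighted_norm_square_le_zero) auto
    \<comment> \<open>Index 0 contributes nothing and index 1 contributes 1 - 49/9 = -40/9.\<close>
    moreover have "(\<Sum>n<N + 2. ((real n)\<^sup>2 - (7 / 3)\<^sup>2) * (norm (A n))\<^sup>2) =
        (\<Sum>n<N. ?t n) / 9 - 40 / 9"
      by (simp add: sum.lessThan_Suc_shift A_def sum_divide_distrib power2_eq_square field_simps
          del: sum.lessThan_Suc)
    ultimately show ?thesis
      by simp
  qed
  \<comment> \<open>The term \<open>?t 0\<close> has the negative weight 36 - 49 = -13, so the
    criterion for nonnegative bounded series is applied after removing it; its value moves into the
    bound.\<close>
  have "summable (\<lambda>n. ?t (Suc n))"
  proof (rule summableI_nonneg_bounded)
    show "0 \<le> ?t (Suc n)" for n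
      using power_mono[of 7 "3 * real (Suc n + 2)" 2] by simp
    show "(\<Sum>n<N. ?t (Suc n)) \<le> 40 - ?t 0" for N
      using partial[of "Suc N"] by (simp add: sum.lessThan_Suc_shift del: sum.lessThan_Suc)
  qed
  then have sm: "summable ?t"
    by (subst (asm) summable_Suc_iff)
  have "(\<Sum>n. ?t n) \<le> 40"
    using summable_LIMSEQ[OF sm] partial by (intro LIMSEQ_le_const2) auto
  with sm show ?thesis
    by blast
qed

end
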